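(* Let $G$ and $H$ be cubic graphs that admit $\mathbb{S}^2$-flows, let $v\in V(G)$ and $w\in V(H)$. Then the graph $H\vartriangleright G$ obtained by injecting $H$ into $G$ at $v$ (using $w$) admits an $\mathbb{S}^2$-flow.
   Context: An $\mathbb{S}^2$-flow of a graph is a map from the edges of some orientation to unit vectors of $\mathbb{R}^3$ such that at every vertex the sum over outgoing edges equals the sum over incoming edges. Injection: suppose $v$ and $w$ are not incident with loops; let $vx_1,vx_2,vx_3$ be the three edges of $G$ at $v$ and $wy_1,wy_2,wy_3$ the three edges of $H$ at $w$. The graph $H\vartriangleright G$ is obtained from the disjoint union of $G-v$ and $H-w$ by adding the three edges $x_1y_1,x_2y_2,x_3y_3$ (equivalently: split $v$ and $w$ into three leaves each and glue the pendant edges pairwise, suppressing the identified vertices). *)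

theory Defs
  imports
    "HOL-Analysis.Analysis"
    "HOL-Library.Uprod"
    "Graph_Theory.Digraph"
begin

text \<open>
  Graphs may have parallel edges and loops: every edge has an unordered pair of ends, and a loop
  at \<open>x\<close> has the ends \<open>Upair x x\<close>. No global finiteness is imposed; cubic graphs are locally
  finite by definition.
\<close>

record ('a, 'e) multigraph =
  vertices :: "'a set"
  edges :: "'e set"
  ends :: "'e \<Rightarrow> 'a uprod"

definition wf_multigraph :: "('a, 'e) multigraph \<Rightarrow> bool" where
  "wf_multigraph G \<longleftrightarrow> (\<forall>e\<in>edges G. set_uprod (ends G e) \<subseteq> vertices G)"

definition edges_at :: "('a, 'e) multigraph \<Rightarrow> 'a \<Rightarrow> 'e set" where
  "edges_at G x = {e \<in> edges G. x \<in> set_uprod (ends G e)}"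

definition loops_at :: "('a, 'e) multigraph \<Rightarrow> 'a \<Rightarrow> 'e set" where
  "loops_at G x = {e \<in> edges G. ends G e = Upair x x}"

text \<open>The second summand makes every loop count twice.\<close>

definition vertex_degree :: "('a, 'e) multigraph \<Rightarrow> 'a \<Rightarrow> nat" where
  "vertex_degree G x = card (edges_at G x) + card (loops_at G x)"

definition cubic :: "('a, 'e) multigraph \<Rightarrow> bool" where
  "cubic G \<longleftrightarrow> wf_multigraph G \<and> (\<forall>x\<in>vertices G. finite (edges_at G x) \<and> vertex_degree G x = 3)"

definition is_orientation :: "('a, 'e) pre_digraph \<Rightarrow> ('a, 'e) multigraph \<Rightarrow> bool" where
  "is_orientation D G \<longleftrightarrow> verts D = vertices G \<and> arcs D = edges G \<and>
     (\<forall>e\<in>edges G. ends G e = Upair (tail D e) (head D e))"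

text \<open>
  The sums below are meant for locally finite digraphs only. A loop is both an outgoing and an
  incoming arc of its vertex.
\<close>

definition S2_flow :: "('a, 'e) pre_digraph \<Rightarrow> ('e \<Rightarrow> real ^ 3) \<Rightarrow> bool" where
  "S2_flow D \<phi> \<longleftrightarrow> (\<forall>e\<in>arcs D. norm (\<phi> e) = 1) \<and>
     (\<forall>x\<in>verts D. (\<Sum>e\<in>out_arcs D x. \<phi> e) = (\<Sum>e\<in>in_arcs D x. \<phi> e))"

definition admits_S2_flow :: "('a, 'e) multigraph \<Rightarrow> bool" where
  "admits_S2_flow G \<longleftrightarrow> (\<exists>D \<phi>. is_orientation D G \<and> S2_flow D \<phi>)"

definition other_end :: "('a, 'e) multigraph \<Rightarrow> 'a \<Rightarrow> 'e \<Rightarrow> 'a" where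
  "other_end G x e = (THE y. ends G e = Upair x y)"

text \<open>
  \<open>edge_labelling G v a\<close> names the three distinct edges \<open>a 1, a 2, a 3\<close> at \<open>v\<close>. In a cubic graph
  such a labelling exists iff \<open>v\<close> is not incident with a loop (lemma \<open>ex_edge_labelling_iff\<close>),
  which is always the case if the graph admits an \<open>S\<^sup>2\<close>-flow (lemma \<open>S2_flow_no_loops\<close>).
\<close>

definition edge_labelling :: "('a, 'e) multigraph \<Rightarrow> 'a \<Rightarrow> (nat \<Rightarrow> 'e) \<Rightarrow> bool" where
  "edge_labelling G v a \<longleftrightarrow> bij_betw a {1..3} (edges_at G v)"

text \<open>
  \<open>inject H w b G v a\<close> is \<open>H \<rhd> G\<close>, obtained by injecting \<open>H\<close> into \<open>G\<close> at \<open>v\<close> using \<open>w\<close>, where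
  \<open>a i = v x\<^sub>i\<close> and \<open>b i = w y\<^sub>i\<close>. Sum types provide the disjoint unions; the edge
  \<open>Inr (Inr i)\<close> is the new edge \<open>x\<^sub>i y\<^sub>i\<close>.
\<close>

definition inject ::
  "('c, 'f) multigraph \<Rightarrow> 'c \<Rightarrow> (nat \<Rightarrow> 'f) \<Rightarrow> ('a, 'e) multigraph \<Rightarrow> 'a \<Rightarrow> (nat \<Rightarrow> 'e) \<Rightarrow>
   ('a + 'c, 'e + 'f + nat) multigraph" where
  "inject H w b G v a =
    \<lparr>vertices = Inl ` (vertices G - {v}) \<union> Inr ` (vertices H - {w}),
     edges = Inl ` (edges G - edges_at G v) \<union> (Inr \<circ> Inl) ` (edges H - edges_at H w) \<union>
       (Inr \<circ> Inr) ` {1..3},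
     ends = (\<lambda>e. case e of
         Inl g \<Rightarrow> map_uprod Inl (ends G g)
       | Inr (Inl h) \<Rightarrow> map_uprod Inr (ends H h)
       | Inr (Inr i) \<Rightarrow> Upair (Inl (other_end G v (a i))) (Inr (other_end H w (b i))))\<rparr>"

lemma ex_edge_labelling_iff:
  assumes "cubic G" "v \<in> vertices G"
  shows "(\<exists>a. edge_labelling G v a) \<longleftrightarrow> loops_at G v = {}"
proof -
  have fin: "finite (edges_at G v)" and d: "card (edges_at G v) + card (loops_at G v) = 3"
    using assms by (auto simp: cubic_def vertex_degree_def)
  have "loops_at G v \<subseteq> edges_at G v"
    by (auto simp: loops_at_def edges_at_def)
  then have "finite (loops_at G v)"
    using fin finite_subset by blast
  then have "loops_at G v = {} \<longleftrightarrow> card (edges_at G v) = card {1..3::nat}"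
    using d by (auto simp flip: card_0_eq)
  also have "\<dots> \<longleftrightarrow> (\<exists>a. bij_betw a {1..3::nat} (edges_at G v))"
    using fin bij_betw_iff_card[of "{1..3::nat}" "edges_at G v"] by auto
  finally show ?thesis
    by (simp add: edge_labelling_def)
qed

lemma S2_flow_no_loops:
  assumes cub: "cubic G" and flow: "admits_S2_flow G" and v: "v \<in> vertices G"
  shows "loops_at G v = {}"
proof (rule ccontr)
  assume ne: "loops_at G v \<noteq> {}"
  have fin: "finite (edges_at G v)" and d: "card (edges_at G v) + card (loops_at G v) = 3"
    using cub v by (auto simp: cubic_def vertex_degree_def)
  have sub: "loops_at G v \<subseteq> edges_at G v"
    by (auto simp: loops_at_def edges_at_def)
  have finl: "finite (loops_at G v)"
    using fin sub finite_subset by blast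
  have "card (loops_at G v) > 0"
    using ne finl by (simp add: card_gt_0_iff)
  moreover have "card (loops_at G v) \<le> card (edges_at G v)"
    using sub fin card_mono by blast
  ultimately have "card (edges_at G v - loops_at G v) = 1"
    using d card_Diff_subset[OF finl sub] by arith
  then obtain e where e: "edges_at G v - loops_at G v = {e}"
    by (auto simp: card_1_singleton_iff)
  obtain D \<phi> where D: "is_orientation D G" and \<phi>: "S2_flow D \<phi>"
    using flow by (auto simp: admits_S2_flow_def)
  have ends: "ends G f = Upair (tail D f) (head D f)" if "f \<in> edges G" for f
    using D that by (simp add: is_orientation_def)
  have arcs: "arcs D = edges G" "verts D = vertices G"
    using D by (auto simp: is_orientation_def)
  have ein: "e \<in> edges G" "v \<in> set_uprod (ends G e)" "ends G e \<noteq> Upair v v"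
    using e by (auto simp: edges_at_def loops_at_def)
  have eq: "f = e" if "f \<in> edges G" "tail D f = v \<or> head D f = v" "\<not> (tail D f = v \<and> head D f = v)" for f
  proof -
    have "f \<in> edges_at G v - loops_at G v"
      using that ends[OF that(1)] by (auto simp: edges_at_def loops_at_def)
    then show ?thesis
      using e by simp
  qed
  have lo: "loops_at G v \<subseteq> out_arcs D v" "loops_at G v \<subseteq> in_arcs D v"
    using ends arcs by (auto simp: loops_at_def out_arcs_def in_arcs_def)
  have sums: "(\<Sum>f\<in>out_arcs D v. \<phi> f) = (\<Sum>f\<in>in_arcs D v. \<phi> f)"
    using \<phi> v arcs by (simp add: S2_flow_def)
  have enl: "e \<notin> loops_at G v"
    using e by auto
  have loops: "f \<in> loops_at G v" if "f \<in> edges G" "tail D f = v" "head D f = v" for f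
    using that ends by (auto simp: loops_at_def)
  have up: "out_arcs D v \<subseteq> insert e (loops_at G v)" "in_arcs D v \<subseteq> insert e (loops_at G v)"
    using eq loops arcs unfolding out_arcs_def in_arcs_def by blast+
  have "\<phi> e = 0"
  proof (cases "tail D e = v")
    case True
    then have "head D e \<noteq> v"
      using ein(3) ends[OF ein(1)] by simp
    then have "e \<notin> in_arcs D v" "e \<in> out_arcs D v"
      using True ein(1) arcs by simp_all
    then have "in_arcs D v = loops_at G v" "out_arcs D v = insert e (loops_at G v)"
      using lo up by blast+
    then show ?thesis
      using sums finl enl by simp
  next
    case False
    then have "head D e = v"
      using ein(2) ends[OF ein(1)] by simp
    then have "e \<in> in_arcs D v" "e \<notin> out_arcs D v"
      using False ein(1) arcs by simp_all
    then have "out_arcs D v = loops_at G v" "in_arcs D v = insert e (loops_at G v)"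
      using lo up by blast+
    then show ?thesis
      using sums finl enl by simp
  qed
  moreover have "norm (\<phi> e) = 1"
    using \<phi> ein arcs by (simp add: S2_flow_def)
  ultimately show False
    by simp
qed

lemma other_end:
  assumes "ends G e = Upair x y"
  shows "other_end G x e = y"
  unfolding other_end_def using assms by (intro the_equality) auto

lemma edge_labelling_ends:
  assumes "cubic G" "v \<in> vertices G" "edge_labelling G v a" "i \<in> {1..3}"
  shows "ends G (a i) = Upair v (other_end G v (a i))"
    and "other_end G v (a i) \<in> vertices G - {v}"
proof -
  have nl: "loops_at G v = {}"
    using ex_edge_labelling_iff[OF assms(1,2)] assms(3) by blast
  have ai: "a i \<in> edges_at G v"
    using assms unfolding edge_labelling_def by (meson bij_betwE)
  then have "v \<in> set_uprod (ends G (a i))"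
    by (simp add: edges_at_def)
  then obtain y where y: "ends G (a i) = Upair v y"
    by (cases "ends G (a i)") auto
  show "ends G (a i) = Upair v (other_end G v (a i))"
    using y other_end[OF y] by simp
  have "y \<noteq> v"
    using nl ai y by (auto simp: loops_at_def edges_at_def)
  moreover have "set_uprod (ends G (a i)) \<subseteq> vertices G"
    using assms(1) ai unfolding cubic_def wf_multigraph_def edges_at_def by blast
  ultimately show "other_end G v (a i) \<in> vertices G - {v}"
    using y other_end[OF y] by simp
qed

lemma edge_labelling_card:
  assumes "cubic G" "v \<in> vertices G" "edge_labelling G v a" "x \<noteq> v"
  shows "card {i \<in> {1..3}. other_end G v (a i) = x} = card (edges_at G x \<inter> edges_at G v)"
proof (rule bij_betw_same_card)
  have bij: "bij_betw a {1..3} (edges_at G v)"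
    using assms by (simp add: edge_labelling_def)
  have iff: "other_end G v (a i) = x \<longleftrightarrow> a i \<in> edges_at G x" if i: "i \<in> {1..3}" for i
  proof -
    have "a i \<in> edges G"
      using bij i by (auto simp: edges_at_def dest: bij_betwE)
    moreover have "x \<in> set_uprod (ends G (a i)) \<longleftrightarrow> other_end G v (a i) = x"
      using assms(4) by (subst edge_labelling_ends(1)[OF assms(1-3) i]) auto
    ultimately show ?thesis
      by (simp add: edges_at_def)
  qed
  have "{i \<in> {1..3}. other_end G v (a i) = x} = {i \<in> {1..3}. a i \<in> edges_at G x}"
    using iff by (intro Collect_cong conj_cong refl)
  moreover have "edges_at G v = a ` {1..3}"
    using bij by (simp add: bij_betw_def)
  moreover have "a ` {i \<in> I. a i \<in> S} = S \<inter> a ` I" for I S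
    by auto
  ultimately have "a ` {i \<in> {1..3}. other_end G v (a i) = x} = edges_at G x \<inter> edges_at G v"
    by (simp only:)
  then show "bij_betw a {i \<in> {1..3}. other_end G v (a i) = x} (edges_at G x \<inter> edges_at G v)"
    by (intro bij_betw_imageI inj_on_subset[OF bij_betw_imp_inj_on[OF bij]]) auto
qed

lemma set_uprod_map_uprod: "set_uprod (map_uprod f u) = f ` set_uprod u"
  by (cases u) auto

lemma map_uprod_eq_loop: "inj f \<Longrightarrow> map_uprod f u = Upair (f x) (f x) \<longleftrightarrow> u = Upair x x"
  by (cases u) (auto dest: injD)

lemma map_uprod_neq_loop:
  "map_uprod Inl u \<noteq> Upair (Inr y) (Inr y)" "map_uprod Inr u' \<noteq> Upair (Inl x) (Inl x)"
  by (cases u; simp) (cases u'; simp)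

text \<open>Sanity check: injection does produce a cubic graph.\<close>

lemma cubic_inject:
  assumes G: "cubic G" "v \<in> vertices G" "edge_labelling G v a"
    and H: "cubic H" "w \<in> vertices H" "edge_labelling H w b"
  shows "cubic (inject H w b G v a)"
  unfolding cubic_def
proof (intro conjI ballI)
  let ?I = "inject H w b G v a"
  have wfG: "set_uprod (ends G e) \<subseteq> vertices G" if "e \<in> edges G" for e
    using G that by (auto simp: cubic_def wf_multigraph_def)
  have wfH: "set_uprod (ends H e) \<subseteq> vertices H" if "e \<in> edges H" for e
    using H that by (auto simp: cubic_def wf_multigraph_def)
  show "wf_multigraph ?I"
    unfolding wf_multigraph_def
  proof
    fix e assume "e \<in> edges ?I"
    then consider g where "e = Inl g" "g \<in> edges G - edges_at G v"
      | h where "e = Inr (Inl h)" "h \<in> edges H - edges_at H w"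
      | i where "e = Inr (Inr i)" "i \<in> {1..3}"
      by (auto simp: inject_def)
    then show "set_uprod (ends ?I e) \<subseteq> vertices ?I"
    proof cases
      case 1
      then have "set_uprod (ends G g) \<subseteq> vertices G - {v}"
        using wfG by (auto simp: edges_at_def)
      then show ?thesis
        using 1 by (auto simp: inject_def set_uprod_map_uprod)
    next
      case 2
      then have "set_uprod (ends H h) \<subseteq> vertices H - {w}"
        using wfH by (auto simp: edges_at_def)
      then show ?thesis
        using 2 by (auto simp: inject_def set_uprod_map_uprod)
    next
      case 3
      then show ?thesis
        using edge_labelling_ends(2)[OF G] edge_labelling_ends(2)[OF H]
        by (auto simp: inject_def)
    qed
  qed
  fix z assume z: "z \<in> vertices ?I"
  have "finite (edges_at ?I z) \<and> vertex_degree ?I z = 3"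
  proof (cases z)
    case (Inl x)
    then have x: "x \<in> vertices G" "x \<noteq> v"
      using z by (auto simp: inject_def)
    have fin: "finite (edges_at G x)"
      and deg: "card (edges_at G x) + card (loops_at G x) = 3"
      using G x by (auto simp: cubic_def vertex_degree_def)
    let ?J = "{i \<in> {1..3}. other_end G v (a i) = x}"
    have E: "edges_at ?I z = Inl ` (edges_at G x - edges_at G v) \<union> (Inr \<circ> Inr) ` ?J"
      by (auto simp: Inl inject_def edges_at_def set_uprod_map_uprod)
    have L: "loops_at ?I z = Inl ` loops_at G x"
      using x by (auto simp: Inl inject_def edges_at_def loops_at_def map_uprod_eq_loop map_uprod_neq_loop)
    have "card (edges_at ?I z) = card (edges_at G x - edges_at G v) + card ?J"
      unfolding E using fin
      by (subst card_Un_disjoint) (auto simp: card_image inj_on_def)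
    also have "\<dots> = card (edges_at G x)"
      using fin edge_labelling_card[OF G x(2)]
      by (metis add.commute card_Int_Diff)
    finally have "card (edges_at ?I z) = card (edges_at G x)" .
    moreover have "finite (edges_at ?I z)"
      unfolding E using fin by simp
    ultimately show ?thesis
      using deg L by (simp add: vertex_degree_def card_image)
  next
    case (Inr x)
    then have x: "x \<in> vertices H" "x \<noteq> w"
      using z by (auto simp: inject_def)
    have fin: "finite (edges_at H x)"
      and deg: "card (edges_at H x) + card (loops_at H x) = 3"
      using H x by (auto simp: cubic_def vertex_degree_def)
    let ?J = "{i \<in> {1..3}. other_end H w (b i) = x}"
    have E: "edges_at ?I z = (Inr \<circ> Inl) ` (edges_at H x - edges_at H w) \<union> (Inr \<circ> Inr) ` ?J"
      by (auto simp: Inr inject_def edges_at_def set_uprod_map_uprod)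
    have L: "loops_at ?I z = (Inr \<circ> Inl) ` loops_at H x"
      using x by (auto simp: Inr inject_def edges_at_def loops_at_def map_uprod_eq_loop map_uprod_neq_loop)
    have "card (edges_at ?I z) = card (edges_at H x - edges_at H w) + card ?J"
      unfolding E using fin
      by (subst card_Un_disjoint) (auto simp: card_image inj_on_def)
    also have "\<dots> = card (edges_at H x)"
      using fin edge_labelling_card[OF H x(2)]
      by (metis add.commute card_Int_Diff)
    finally have "card (edges_at ?I z) = card (edges_at H x)" .
    moreover have "finite (edges_at ?I z)"
      unfolding E using fin by simp
    ultimately show ?thesis
      using deg L by (simp add: vertex_degree_def card_image inj_on_def)
  qed
  then show "finite (edges_at ?I z)" "vertex_degree ?I z = 3"
    by auto
qed

end

theory Submission
  imports Defs
begin

text \<open>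
  Measure a flow at a vertex by the signed values leaving it. The three unit vectors leaving \<open>v\<close>
  sum to zero, hence pairwise have inner product \<open>-1/2\<close>, and the same holds at \<open>w\<close>. So some linear
  isometry carries the triple at \<open>w\<close> to the negated triple at \<open>v\<close>. After applying it to the
  flow on \<open>H\<close>, the two flows agree on the glued edges.
\<close>

section \<open>Reflections and isometries between triples of unit vectors\<close>

text \<open>This is the reflection in the hyperplane orthogonal to \<open>d\<close>. At
  \<open>d = 0\<close> it is the identity, so the case of two vectors that already agree is covered
  too.\<close>

definition reflect_along :: "'a::real_inner \<Rightarrow> 'a \<Rightarrow> 'a" where
  "reflect_along d x = x - (2 * (x \<bullet> d) / (d \<bullet> d)) *\<^sub>R d"

lemma orthogonal_transformation_reflect_along: "orthogonal_transformation (reflect_along d)"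
proof -
  have "linear (reflect_along d)"
    by (rule linearI)
      (simp_all add: reflect_along_def inner_add_left algebra_simps add_divide_distrib)
  moreover have "reflect_along d x \<bullet> reflect_along d y = x \<bullet> y" for x y
    by (cases "d = 0")
      (simp_all add: reflect_along_def inner_diff_left inner_diff_right inner_commute[of d y])
  ultimately show ?thesis
    by (simp add: orthogonal_transformation_def)
qed

text \<open>Equal norms make \<open>x + y\<close> orthogonal to \<open>x - y\<close>, so the
  component of \<open>x\<close> along \<open>x - y\<close> is half of \<open>x - y\<close>; the
  reflection subtracts it twice.\<close>

lemma reflect_along_diff:
  assumes "norm x = norm y"
  shows "reflect_along (x - y) x = y"
proof (cases "x = y")
  case True
  then show ?thesis
    by (simp add: reflect_along_def)
next
  case False
  have "x \<bullet> x = y \<bullet> y"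
    using assms by (simp add: norm_eq)
  then have "2 * (x \<bullet> (x - y)) = (x - y) \<bullet> (x - y)"
    by (simp add: inner_diff_left inner_diff_right inner_commute)
  then show ?thesis
    using False by (simp add: reflect_along_def)
qed

lemma reflect_along_orthogonal: "z \<bullet> d = 0 \<Longrightarrow> reflect_along d z = z"
  by (simp add: reflect_along_def)

text \<open>Two reflections suffice: the first takes care of the first vector, and the second
  corrects the image of the second vector while fixing \<open>r\<^sub>1\<close>. No basis has to be
  completed.\<close>

lemma ex_orthogonal_transformation_pair:
  fixes q\<^sub>1 q\<^sub>2 r\<^sub>1 r\<^sub>2 :: "'a::real_inner"
  assumes "norm q\<^sub>1 = norm r\<^sub>1" "norm q\<^sub>2 = norm r\<^sub>2" "q\<^sub>1 \<bullet> q\<^sub>2 = r\<^sub>1 \<bullet> r\<^sub>2"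
  obtains f where "orthogonal_transformation f" "f q\<^sub>1 = r\<^sub>1" "f q\<^sub>2 = r\<^sub>2"
proof -
  define g where "g = reflect_along (q\<^sub>1 - r\<^sub>1)"
  have g: "orthogonal_transformation g" "g q\<^sub>1 = r\<^sub>1"
    using assms(1)
    by (auto simp: g_def orthogonal_transformation_reflect_along reflect_along_diff)
  define h where "h = reflect_along (g q\<^sub>2 - r\<^sub>2)"
  have "norm (g q\<^sub>2) = norm r\<^sub>2"
    using g(1) assms(2) by (simp add: orthogonal_transformation_norm)
  then have "h (g q\<^sub>2) = r\<^sub>2"
    by (simp add: h_def reflect_along_diff)
  \<comment> \<open>Since \<open>r\<^sub>1 = g q\<^sub>1\<close> and \<open>g\<close> preserves
    inner products, \<open>r\<^sub>1\<close> is orthogonal to \<open>g q\<^sub>2 - r\<^sub>2\<close>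
    and hence lies in the mirror of \<open>h\<close>.\<close>
  moreover have "r\<^sub>1 \<bullet> g q\<^sub>2 = r\<^sub>1 \<bullet> r\<^sub>2"
    using g assms(3) by (metis orthogonal_transformation_def)
  then have "h r\<^sub>1 = r\<^sub>1"
    by (simp add: h_def reflect_along_orthogonal inner_diff_right)
  moreover have "orthogonal_transformation (h \<circ> g)"
    using g(1) by (simp add: h_def orthogonal_transformation_compose
        orthogonal_transformation_reflect_along)
  ultimately show thesis
    using that[of "h \<circ> g"] g(2) by simp
qed

text \<open>Taking the squared norm of the third vector, the negated sum of the other two, gives
  \<open>1 = 2 + 2 * (p 1 \<bullet> p 2)\<close>.\<close>

lemma unit_triple_inner:
  fixes p :: "nat \<Rightarrow> 'a::real_inner"
  assumes "\<And>i. i \<in> {1..3} \<Longrightarrow> norm (p i) = 1" "sum p {1..3} = 0"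
  shows "p 1 \<bullet> p 2 = - 1 / 2" "p 3 = - p 1 - p 2"
proof -
  have "p 1 + p 2 + p 3 = 0"
    using assms(2) by (simp add: numeral_3_eq_3 numeral_2_eq_2 add.assoc)
  then show p3: "p 3 = - p 1 - p 2"
    by (simp add: algebra_simps eq_neg_iff_add_eq_0)
  have one: "p i \<bullet> p i = 1" if "i \<in> {1..3}" for i
    using assms(1)[OF that] by (simp add: norm_eq_1)
  have "p 3 \<bullet> p 3 = p 1 \<bullet> p 1 + 2 * (p 1 \<bullet> p 2) + p 2 \<bullet> p 2"
    unfolding p3 by (simp add: inner_diff_left inner_diff_right inner_commute)
  then show "p 1 \<bullet> p 2 = - 1 / 2"
    using one[of 1] one[of 2] one[of 3] by simp
qed

text \<open>Degree three enters here: a zero sum of three unit vectors fixes all their inner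
  products, which fails for four. An isometry matching two of the vectors matches the third by
  linearity.\<close>

lemma ex_orthogonal_transformation_unit_triple:
  fixes q r :: "nat \<Rightarrow> 'a::real_inner"
  assumes q: "\<And>i. i \<in> {1..3} \<Longrightarrow> norm (q i) = 1" "sum q {1..3} = 0"
    and r: "\<And>i. i \<in> {1..3} \<Longrightarrow> norm (r i) = 1" "sum r {1..3} = 0"
  obtains f where "orthogonal_transformation f" "\<And>i. i \<in> {1..3} \<Longrightarrow> f (q i) = r i"
proof -
  have "norm (q 1) = norm (r 1)" "norm (q 2) = norm (r 2)"
    using q(1) r(1) by simp_all
  moreover have "q 1 \<bullet> q 2 = r 1 \<bullet> r 2"
    using unit_triple_inner(1)[OF q] unit_triple_inner(1)[OF r] by simp
  ultimately obtain f where f: "orthogonal_transformation f" "f (q 1) = r 1" "f (q 2) = r 2"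
    by (rule ex_orthogonal_transformation_pair)
  have "q 3 = - q 1 - q 2" "r 3 = - r 1 - r 2"
    by (rule unit_triple_inner(2); fact)+
  then have "f (q 3) = r 3"
    using f orthogonal_transformation_linear[OF f(1)] by (simp add: linear_diff linear_neg)
  then have "f (q i) = r i" if "i \<in> {1..3}" for i
  proof -
    have "i = 1 \<or> i = 2 \<or> i = 3"
      using that by auto
    then show ?thesis
      using f(2,3) \<open>f (q 3) = r 3\<close> by auto
  qed
  with f(1) show thesis
    by (rule that)
qed

section \<open>Signed flow values at a vertex and after deleting a neighbour\<close>

text \<open>A loop contributes \<open>0\<close>.\<close>

definition outflow ::
  "('a, 'e) pre_digraph \<Rightarrow> ('e \<Rightarrow> 'b::real_vector) \<Rightarrow> 'a \<Rightarrow> 'e \<Rightarrow> 'b" where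
  "outflow D \<phi> x e = (of_bool (tail D e = x) - of_bool (head D e = x)) *\<^sub>R \<phi> e"

lemma edges_at_orientation:
  assumes "is_orientation D G"
  shows "edges_at G x = {e \<in> edges G. tail D e = x \<or> head D e = x}"
  using assms by (auto simp: is_orientation_def edges_at_def)

lemma sum_outflow:
  assumes "is_orientation D G" "finite (edges_at G x)"
  shows "sum (outflow D \<phi> x) (edges_at G x) = sum \<phi> (out_arcs D x) - sum \<phi> (in_arcs D x)"
proof -
  have arcs: "arcs D = edges G"
    using assms(1) by (simp add: is_orientation_def)
  have "out_arcs D x = {e \<in> edges_at G x. tail D e = x}"
    "in_arcs D x = {e \<in> edges_at G x. head D e = x}"
    by (auto simp: arcs edges_at_orientation[OF assms(1)])
  moreover have "outflow D \<phi> x e =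
      (if tail D e = x then \<phi> e else 0) - (if head D e = x then \<phi> e else 0)" for e
    by (simp add: outflow_def)
  ultimately show ?thesis
    using assms(2) by (simp add: sum_subtractf sum.inter_filter)
qed

text \<open>Conservation becomes a single sum over the undirected edges at a vertex, so it can be
  split along the edge sets from which the injected graph is built.\<close>

lemma S2_flow_iff_outflow:
  assumes "is_orientation D G" "cubic G"
  shows "S2_flow D \<phi> \<longleftrightarrow> (\<forall>e\<in>edges G. norm (\<phi> e) = 1) \<and>
    (\<forall>x\<in>vertices G. sum (outflow D \<phi> x) (edges_at G x) = 0)"
proof -
  have "sum (outflow D \<phi> x) (edges_at G x) = sum \<phi> (out_arcs D x) - sum \<phi> (in_arcs D x)"
    if "x \<in> vertices G" for x
    using that assms by (intro sum_outflow) (auto simp: cubic_def)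
  then show ?thesis
    using assms(1) by (auto simp: S2_flow_def is_orientation_def)
qed

context
  fixes G :: "('a, 'e) multigraph" and v a D \<phi>
  assumes G: "cubic G" "v \<in> vertices G" "edge_labelling G v a"
    and D: "is_orientation D G" and flow: "S2_flow D \<phi>"
begin

text \<open>A labelled edge is not a loop, so exactly one of the two indicators in
  \<open>outflow\<close> is 1.\<close>

lemma norm_outflow_labelling:
  assumes "i \<in> {1..3}"
  shows "norm (outflow D \<phi> v (a i)) = 1"
proof -
  have "a i \<in> edges G"
    using G(3) assms by (auto simp: edge_labelling_def edges_at_def dest: bij_betwE)
  then have "norm (\<phi> (a i)) = 1" "ends G (a i) = Upair (tail D (a i)) (head D (a i))"
    using D flow by (auto simp: S2_flow_def is_orientation_def)
  then show ?thesis
    using edge_labelling_ends[OF G assms] by (auto simp: outflow_def)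
qed

lemma sum_outflow_labelling: "(\<Sum>i\<in>{1..3}. outflow D \<phi> v (a i)) = 0"
proof -
  have "(\<Sum>i\<in>{1..3}. outflow D \<phi> v (a i)) = sum (outflow D \<phi> v) (edges_at G v)"
    using G(3) by (intro sum.reindex_bij_betw) (simp add: edge_labelling_def)
  then show ?thesis
    using flow G(2) by (simp add: S2_flow_iff_outflow[OF D G(1)])
qed

text \<open>The surviving edges at \<open>x\<close> must balance the deleted ones. A deleted edge
  leaves \<open>x\<close> with the negative of the value with which it leaves \<open>v\<close>, so
  the two signs cancel. Parallel edges give several indices \<open>i\<close>.\<close>

lemma sum_outflow_remove_vertex:
  assumes x: "x \<in> vertices G" "x \<noteq> v"
  shows "sum (outflow D \<phi> x) (edges_at G x - edges_at G v) =
    (\<Sum>i\<in>{i\<in>{1..3}. other_end G v (a i) = x}. outflow D \<phi> v (a i))"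
proof -
  let ?J = "{i\<in>{1..3}. other_end G v (a i) = x}"
  have bij: "bij_betw a {1..3} (edges_at G v)"
    using G(3) by (simp add: edge_labelling_def)
  have ends: "ends G (a i) = Upair (tail D (a i)) (head D (a i))"
    "ends G (a i) = Upair v (other_end G v (a i))" "a i \<in> edges G" if "i \<in> {1..3}" for i
    using that D bij edge_labelling_ends(1)[OF G that]
    by (auto simp: is_orientation_def edges_at_def dest: bij_betwE)
  have "other_end G v (a i) = x \<longleftrightarrow> a i \<in> edges_at G x" if "i \<in> {1..3}" for i
    using ends[OF that] x(2) by (auto simp: edges_at_def)
  then have "?J = {i\<in>{1..3}. a i \<in> edges_at G x}"
    by blast
  then have J: "a ` ?J = edges_at G x \<inter> edges_at G v"
    unfolding bij_betw_imp_surj_on[OF bij, symmetric] by blast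
  have inj: "inj_on a ?J"
    by (rule inj_on_subset[OF bij_betw_imp_inj_on[OF bij]]) auto
  \<comment> \<open>The edge joins the distinct vertices \<open>v\<close> and \<open>x\<close>, so
    one is its tail and the other its head.\<close>
  have swap: "outflow D \<phi> x (a i) = - outflow D \<phi> v (a i)" if "i \<in> ?J" for i
    using ends(1,2)[of i] that x(2) by (auto simp: outflow_def)
  have fin: "finite (edges_at G x)"
    using G(1) x(1) by (simp add: cubic_def)
  have "0 = sum (outflow D \<phi> x) (edges_at G x)"
    using flow x(1) by (simp add: S2_flow_iff_outflow[OF D G(1)])
  also have "\<dots> = sum (outflow D \<phi> x) (edges_at G x \<inter> edges_at G v) +
      sum (outflow D \<phi> x) (edges_at G x - edges_at G v)"
    by (rule sum.Int_Diff[OF fin])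
  also have "sum (outflow D \<phi> x) (edges_at G x \<inter> edges_at G v) =
      - (\<Sum>i\<in>?J. outflow D \<phi> v (a i))"
    unfolding J[symmetric] sum.reindex[OF inj] o_def sum_negf[symmetric]
    by (intro sum.cong refl swap)
  finally show ?thesis
    by simp
qed

end

section \<open>The flow on the injected graph\<close>

lemma edges_at_inject:
  "edges_at (inject H w b G v a) (Inl x) =
    Inl ` (edges_at G x - edges_at G v) \<union>
    (Inr \<circ> Inr) ` {i \<in> {1..3}. other_end G v (a i) = x}"
  "edges_at (inject H w b G v a) (Inr y) =
    (Inr \<circ> Inl) ` (edges_at H y - edges_at H w) \<union>
    (Inr \<circ> Inr) ` {i \<in> {1..3}. other_end H w (b i) = y}"
  by (auto simp: inject_def edges_at_def set_uprod_map_uprod)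

theorem theorem4p9:
  fixes G :: "('a, 'e) multigraph" and H :: "('c, 'f) multigraph"
    and v :: 'a and w :: 'c
    and a :: "nat \<Rightarrow> 'e" and b :: "nat \<Rightarrow> 'f"
  assumes "cubic G" and "cubic H"
    and "admits_S2_flow G" and "admits_S2_flow H"
    and "v \<in> vertices G" and "w \<in> vertices H"
    and "edge_labelling G v a" and "edge_labelling H w b"
  shows "admits_S2_flow (inject H w b G v a)"
proof -
  let ?I = "inject H w b G v a"
  note G = \<open>cubic G\<close> \<open>v \<in> vertices G\<close> \<open>edge_labelling G v a\<close>
  note H = \<open>cubic H\<close> \<open>w \<in> vertices H\<close> \<open>edge_labelling H w b\<close>
  obtain D \<phi> where D: "is_orientation D G" and \<phi>: "S2_flow D \<phi>"
    using assms(3) by (auto simp: admits_S2_flow_def)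
  obtain E \<psi> where E: "is_orientation E H" and \<psi>: "S2_flow E \<psi>"
    using assms(4) by (auto simp: admits_S2_flow_def)
  note flowG = G D \<phi> and flowH = H E \<psi>
  define p where "p i = outflow D \<phi> v (a i)" for i
  define q where "q i = outflow E \<psi> w (b i)" for i
  \<comment> \<open>The edge from \<open>v\<close> leaves its other end with value
    \<open>- p i\<close>, so the glued edge must leave its end in \<open>H\<close> with
    \<open>p i\<close>. The edge from \<open>w\<close> leaves that end with \<open>- q i\<close>,
    which \<open>f\<close> has to map to \<open>p i\<close>.\<close>
  obtain f where f: "orthogonal_transformation f"
    and fq: "\<And>i. i \<in> {1..3} \<Longrightarrow> f (q i) = - p i"
  proof (rule ex_orthogonal_transformation_unit_triple[of q "\<lambda>i. - p i"])
    show "norm (q i) = 1" "norm (- p i) = 1" if "i \<in> {1..3}" for i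
      using norm_outflow_labelling[OF flowG that] norm_outflow_labelling[OF flowH that]
      by (simp_all add: p_def q_def)
    show "sum q {1..3} = 0" "(\<Sum>i\<in>{1..3}. - p i) = 0"
      using sum_outflow_labelling[OF flowG] sum_outflow_labelling[OF flowH]
      by (simp_all add: p_def q_def sum_negf)
  next
    fix f assume "orthogonal_transformation f" "\<And>i. i \<in> {1..3} \<Longrightarrow> f (q i) = - p i"
    then show thesis
      by (rule that)
  qed
  have lin: "linear f"
    using f by (rule orthogonal_transformation_linear)
  define K :: "('a + 'c, 'e + 'f + nat) pre_digraph" where
    "K = \<lparr>verts = vertices ?I, arcs = edges ?I,
      tail = (\<lambda>e. case e of Inl g \<Rightarrow> Inl (tail D g) | Inr (Inl h) \<Rightarrow> Inr (tail E h)
        | Inr (Inr i) \<Rightarrow> Inl (other_end G v (a i))),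
      head = (\<lambda>e. case e of Inl g \<Rightarrow> Inl (head D g) | Inr (Inl h) \<Rightarrow> Inr (head E h)
        | Inr (Inr i) \<Rightarrow> Inr (other_end H w (b i)))\<rparr>"
  \<comment> \<open>New edges run from the \<open>G\<close> side to the \<open>H\<close> side, so
    \<open>- p i\<close> is what the deleted edge at \<open>v\<close> carried out of its other
    end.\<close>
  define \<omega> where
    "\<omega> e = (case e of Inl g \<Rightarrow> \<phi> g | Inr (Inl h) \<Rightarrow> f (\<psi> h) | Inr (Inr i) \<Rightarrow> - p i)" for e
  have K: "is_orientation K ?I"
    using D E by (auto simp: is_orientation_def K_def inject_def)
  have "S2_flow K \<omega>"
    unfolding S2_flow_iff_outflow[OF K cubic_inject[OF G H]]
  proof (intro conjI ballI)
    fix e assume "e \<in> edges ?I"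
    then show "norm (\<omega> e) = 1"
      using \<phi> \<psi> D E norm_outflow_labelling[OF flowG] orthogonal_transformation_norm[OF f]
      by (auto simp: inject_def \<omega>_def p_def S2_flow_def is_orientation_def)
  next
    fix z assume z: "z \<in> vertices ?I"
    show "sum (outflow K \<omega> z) (edges_at ?I z) = 0"
    proof (cases z)
      case (Inl x)
      then have x: "x \<in> vertices G" "x \<noteq> v"
        using z by (auto simp: inject_def)
      let ?J = "{i \<in> {1..3}. other_end G v (a i) = x}"
      have fin: "finite (edges_at G x)"
        using G(1) x(1) by (simp add: cubic_def)
      have "sum (outflow K \<omega> z) (edges_at ?I z) =
          sum (outflow D \<phi> x) (edges_at G x - edges_at G v) + (\<Sum>i\<in>?J. - p i)"
        unfolding Inl edges_at_inject using fin
        by (subst sum.union_disjoint)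
          (auto simp: sum.reindex inj_on_def outflow_def K_def \<omega>_def intro!: sum.cong)
      then show ?thesis
        using sum_outflow_remove_vertex[OF flowG x] by (simp add: p_def sum_negf)
    next
      case (Inr y)
      then have y: "y \<in> vertices H" "y \<noteq> w"
        using z by (auto simp: inject_def)
      let ?J = "{i \<in> {1..3}. other_end H w (b i) = y}"
      have fin: "finite (edges_at H y)"
        using H(1) y(1) by (simp add: cubic_def)
      \<comment> \<open>The new edges enter \<open>y\<close>, which turns their value
        \<open>- p i\<close> into \<open>p i\<close>. On the old edges the sign factor of
        \<open>outflow\<close> passes through the linear map \<open>f\<close>.\<close>
      have "sum (outflow K \<omega> z) (edges_at ?I z) =
          (\<Sum>h\<in>edges_at H y - edges_at H w. f (outflow E \<psi> y h)) + (\<Sum>i\<in>?J. p i)"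
        unfolding Inr edges_at_inject using fin
        by (subst sum.union_disjoint)
          (auto simp: sum.reindex inj_on_def outflow_def K_def \<omega>_def linear_scale[OF lin]
            intro!: sum.cong)
      also have "(\<Sum>i\<in>?J. p i) = - (\<Sum>i\<in>?J. f (q i))"
        by (simp add: fq sum_negf)
      \<comment> \<open>This is the balance in \<open>H\<close> without \<open>w\<close>, pushed
        through \<open>f\<close> by linearity.\<close>
      also have "(\<Sum>h\<in>edges_at H y - edges_at H w. f (outflow E \<psi> y h)) = (\<Sum>i\<in>?J. f (q i))"
        using sum_outflow_remove_vertex[OF flowH y]
        by (simp add: linear_sum[OF lin, symmetric] q_def)
      finally show ?thesis
        by simp
    qed
  qed
  with K show ?thesis
    by (auto simp: admits_S2_flow_def)
qed

end
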